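(* Let $T$ be a locally finite spherically regular rooted tree and let $G\leq\operatorname{Aut}(T)$ be a group such that $\operatorname{Rist}_G(v)$ is infinite for every vertex $v$ of $T$. Then every weakly maximal subgroup of $G$ is infinite.
   Context: All rooted trees are infinite and spherically regular (the number of children of a vertex depends only on its level, i.e. its distance to the root), and every vertex has at least two children. $\operatorname{Aut}(T)$ is the group of graph automorphisms of $T$ fixing the root. For a vertex $v$, $T_v$ is the subtree of all descendants of $v$ (including $v$). For $G\le\operatorname{Aut}(T)$, the rigid stabilizer $\operatorname{Rist}_G(v)$ is the subgroup of all elements of $G$ acting trivially on $T\setminus T_v$. A subgroup $W<G$ is weakly maximal if it is maximal (for inclusion) among the subgroups of infinite index of $G$. *)

theory Defs
  imports
    "HOL-Algebra.Coset"
    "HOL-Algebra.Bij"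
    "HOL-Library.Equipollence"
    "Graph_Theory.Pair_Digraph"
    "Graph_Theory.Digraph_Component"
begin

text \<open>
  Undirected simple graphs, possibly infinite, are symmetric loop-free sets of pairs. The predicate
  \<open>tree\<close> of \<open>Graph_Theory\<close> is not usable here: it also forbids the closed walk
  \<open>u, v, u\<close> along a single edge, so no symmetric graph with an edge satisfies it. In a
  simple graph the closed walks with distinct vertices other than these have length at least 3.
\<close>

locale rooted_tree = pair_bidirected_digraph T for T :: "'v pair_pre_digraph" +
  fixes r :: 'v
  assumes root_in_verts: "r \<in> pverts T"
    and tree_connected: "connected (with_proj T)"
    and tree_acyclic: "\<not> (\<exists>p. cycle p \<and> 3 \<le> length p)"
begin

definition level :: "'v \<Rightarrow> nat" where
  "level v = (LEAST n. \<exists>p. awalk r p v \<and> length p = n)"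

definition children :: "'v \<Rightarrow> 'v set" where
  "children v = {w. (v, w) \<in> parcs T \<and> level w = Suc (level v)}"

definition descendants :: "'v \<Rightarrow> 'v set" where
  "descendants v = {w. (v, w) \<in> {(x, y). y \<in> children x}\<^sup>*}"

definition locally_finite :: bool where
  "locally_finite \<longleftrightarrow> (\<forall>v\<in>pverts T. finite {w. (v, w) \<in> parcs T})"

definition tree_automorphisms :: "('v \<Rightarrow> 'v) set" where
  "tree_automorphisms =
     {g \<in> Bij (pverts T). g r = r \<and>
        (\<forall>x\<in>pverts T. \<forall>y\<in>pverts T. (g x, g y) \<in> parcs T \<longleftrightarrow> (x, y) \<in> parcs T)}"

definition Aut :: "('v \<Rightarrow> 'v) monoid" where
  "Aut = BijGroup (pverts T) \<lparr>carrier := tree_automorphisms\<rparr>"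

definition Rist :: "('v \<Rightarrow> 'v) set \<Rightarrow> 'v \<Rightarrow> ('v \<Rightarrow> 'v) set" where
  "Rist G v = {g \<in> G. \<forall>x\<in>pverts T - descendants v. g x = x}"

end

locale spherically_regular_rooted_tree = rooted_tree +
  assumes infinite_verts: "infinite (pverts T)"
    and spherically_regular:
      "\<And>v w. v \<in> pverts T \<Longrightarrow> w \<in> pverts T \<Longrightarrow> level v = level w \<Longrightarrow> children v \<approx> children w"
    and two_children:
      "\<And>v. v \<in> pverts T \<Longrightarrow> \<exists>a b. a \<noteq> b \<and> {a, b} \<subseteq> children v"

definition infinite_index :: "'a set \<Rightarrow> ('a, 'b) monoid_scheme \<Rightarrow> bool" where
  "infinite_index H G \<longleftrightarrow> infinite (rcosets\<^bsub>G\<^esub> H)"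

definition weakly_maximal :: "'a set \<Rightarrow> ('a, 'b) monoid_scheme \<Rightarrow> bool" where
  "weakly_maximal W G \<longleftrightarrow>
     subgroup W G \<and> infinite_index W G \<and>
     (\<forall>H. subgroup H G \<and> infinite_index H G \<and> W \<subseteq> H \<longrightarrow> H = W)"

end

theory Submission
  imports Defs
begin

text \<open>
  Suppose \<open>W\<close> is finite. Levels are arbitrarily large, so some level contains vertices \<open>u\<close> and \<open>v\<close>
  with \<open>v\<close> outside the orbit \<open>W u\<close>. Let \<open>D\<close> be the union of the subtrees at the vertices of \<open>W u\<close>
  and let \<open>H\<close> be the group of all \<open>g \<in> G\<close> that agree on \<open>D\<close> with some element of \<open>W\<close>. It contains
  \<open>W\<close> as well as the infinite group \<open>Rist v\<close>, so it is strictly larger than \<open>W\<close>. An element of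
  \<open>H \<inter> Rist u\<close> is determined by an element of \<open>W\<close> it agrees with on \<open>T\<^sub>u\<close>, so this intersection is
  finite; as \<open>Rist u\<close> is infinite, \<open>H\<close> has infinite index and \<open>W\<close> is not weakly maximal.
\<close>

section \<open>Subgroups of infinite index\<close>

text \<open>Two elements of \<open>K\<close> in the same right coset of \<open>H\<close> differ by
  an element of \<open>H \<inter> K\<close>. With finitely many cosets, the pigeonhole principle
  would put infinitely many elements of \<open>K\<close> into one coset \<open>H #> a\<close>, and
  right multiplication by \<open>inv a\<close> would inject them into the finite
  intersection.\<close>

lemma (in group) infinite_index_if_finite_Int:
  assumes H: "subgroup H G" and K: "subgroup K G" and "infinite K" and fin: "finite (H \<inter> K)"
  shows "infinite_index H G"
  unfolding infinite_index_def
proof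
  assume "finite (rcosets H)"
  moreover have "(\<lambda>x. H #> x) ` K \<subseteq> rcosets H"
    using subgroup.subset[OF K] by (auto simp: RCOSETS_def)
  ultimately have "finite ((\<lambda>x. H #> x) ` K)"
    by (rule finite_subset[rotated])
  then obtain a where a: "a \<in> K" and inf: "infinite {x \<in> K. H #> x = H #> a}" (is "infinite ?F")
    using pigeonhole_infinite[OF \<open>infinite K\<close>] by blast
  have aG: "a \<in> carrier G" and FG: "\<And>x. x \<in> ?F \<Longrightarrow> x \<in> carrier G"
    using a subgroup.subset[OF K] by auto
  have "x \<otimes> inv a \<in> H \<inter> K" if "x \<in> ?F" for x
  proof -
    have "x \<in> H #> a" using rcos_self[OF FG[OF that] H] that by simp
    then have "x \<otimes> inv a \<in> H" using subgroup.rcos_module_imp[OF H is_group aG] by blast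
    then show ?thesis using that a K by (simp add: subgroup.m_closed subgroup.m_inv_closed)
  qed
  then have "(\<lambda>x. x \<otimes> inv a) ` ?F \<subseteq> H \<inter> K" by blast
  moreover have "inj_on (\<lambda>x. x \<otimes> inv a) ?F"
    using FG aG by (auto intro!: inj_onI)
  ultimately show False
    using inf fin by (meson finite_imageD finite_subset)
qed

section \<open>Walks, levels and uniqueness of parents\<close>

context rooted_tree
begin

lemma childD:
  assumes "y \<in> children x"
  shows "(x, y) \<in> parcs T" "level y = Suc (level x)" "x \<in> pverts T" "y \<in> pverts T"
  using assms by (auto simp: children_def dest: in_arcsD1 in_arcsD2)

text \<open>Relational powers are easier to transport along an automorphism than arc lists. The
  induction removes the first arc, so the starting vertex has to be arbitrary.\<close>

lemma ex_walk_iff_relpow: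
  "(\<exists>p. awalk r p v \<and> length p = n) \<longleftrightarrow> (r, v) \<in> parcs T ^^ n"
proof -
  have "u \<in> pverts T \<Longrightarrow> (\<exists>p. awalk u p v \<and> length p = n) \<longleftrightarrow> (u, v) \<in> parcs T ^^ n" for u
  proof (induction n arbitrary: u)
    case 0
    then show ?case by (auto simp: awalk_Nil_iff)
  next
    case (Suc n)
    show ?case
    proof
      assume "\<exists>p. awalk u p v \<and> length p = Suc n"
      then obtain e q where "awalk u (e # q) v" "length q = n"
        by (metis length_Suc_conv)
      then have "(u, snd e) \<in> parcs T" "awalk (snd e) q v"
        by (auto simp: awalk_Cons_iff)
      with Suc.IH[of "snd e"] \<open>length q = n\<close> show "(u, v) \<in> parcs T ^^ Suc n"
        by (metis in_arcsD2 relpow_Suc_I2)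
    next
      assume "(u, v) \<in> parcs T ^^ Suc n"
      then obtain y where y: "(u, y) \<in> parcs T" "(y, v) \<in> parcs T ^^ n"
        by (meson relpow_Suc_D2)
      then obtain q where "awalk y q v" "length q = n"
        using Suc.IH[of y] in_arcsD2 by blast
      with y have "awalk u ((u, y) # q) v" "length ((u, y) # q) = Suc n"
        by (auto simp: awalk_Cons_iff)
      then show "\<exists>p. awalk u p v \<and> length p = Suc n" by blast
    qed
  qed
  then show ?thesis using root_in_verts .
qed

lemma level_relpow: "level v = (LEAST n. (r, v) \<in> parcs T ^^ n)"
  by (simp add: level_def ex_walk_iff_relpow)

lemma level_le: "awalk r p v \<Longrightarrow> level v \<le> length p"
  unfolding level_def by (rule Least_le) blast

lemma shortest_walk:
  assumes "v \<in> pverts T"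
  obtains p where "awalk r p v" "length p = level v"
proof -
  have "r \<rightarrow>\<^sup>*\<^bsub>mk_symmetric (with_proj T)\<^esub> v"
    using tree_connected assms root_in_verts
    by (auto simp: connected_def strongly_connected_def)
  then have "r \<rightarrow>\<^sup>*\<^bsub>with_proj T\<^esub> v"
    using reachable_mk_symmetric_eq[OF pair_sym_arcs] by simp
  then have "\<exists>n p. awalk r p v \<and> length p = n" using reachable_awalk by simp
  from LeastI_ex[OF this] have "\<exists>p. awalk r p v \<and> length p = level v"
    unfolding level_def .
  then show ?thesis using that by blast
qed

lemma level_le_of_mem_walk:
  assumes "awalk r p v" and "x \<in> set (pawalk_verts r p)"
  shows "level x \<le> length p"
proof -
  obtain q s where "p = q @ s" "awalk r q x"
    using awalk_decomp[OF assms] by blast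
  then show ?thesis using level_le[of q x] by simp
qed

text \<open>Two distinct parents of \<open>x\<close> would be joined by a path through vertices no
  deeper than themselves, obtained by going up to the root and down again. Such a path avoids the
  deeper vertex \<open>x\<close>, so closing it through \<open>x\<close> yields a cycle of length at
  least 3.\<close>

lemma unique_parent:
  assumes "x \<in> children y" and "x \<in> children z"
  shows "y = z"
proof (rule ccontr)
  assume "y \<noteq> z"
  note y = childD[OF assms(1)] and z = childD[OF assms(2)]
  obtain p where p: "awalk r p y" "length p = level y" using shortest_walk[OF y(3)] .
  obtain p' where p': "awalk r p' z" "length p' = level z" using shortest_walk[OF z(3)] .
  have yr: "awalk y (rev_path p) r" and yrv: "pawalk_verts y (rev_path p) = rev (pawalk_verts r p)"
    using awalk_rev_path'[OF p(1)] awalk_verts_rev_path[OF p(1)] by auto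
  define s where "s = rev_path p @ p'"
  have s: "awalk y s z" unfolding s_def using yr p'(1) by (rule awalk_appendI)
  define q where "q = awalk_to_apath s"
  have q: "apath y q z" unfolding q_def using s by (rule apath_awalk_to_apath)
  have qs: "set q \<subseteq> set s" unfolding q_def using s by (rule awalk_to_apath_subset)
  have qw: "awalk y q z" and qd: "distinct (pawalk_verts y q)"
    using q by (auto simp: apath_def)
  have "q \<noteq> []" using qw \<open>y \<noteq> z\<close> by (auto simp: awalk_Nil_iff)
  have sv: "w \<in> set (pawalk_verts r p) \<union> set (pawalk_verts r p')" if "w \<in> set (pawalk_verts y s)" for w
  proof -
    have "pawalk_verts y s = pawalk_verts y (rev_path p) @ tl (pawalk_verts r p')"
      using awalk_verts_append[of y "rev_path p" p' z] s awlast_if_cas yr unfolding s_def by auto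
    then show ?thesis using that yrv by (auto dest: list.set_sel(2)[rotated])
  qed
  \<comment> \<open>Shortening keeps only arcs of \<open>s\<close>, and every vertex of
    \<open>q\<close> is \<open>y\<close> or an endpoint of one of its arcs.\<close>
  have "set (pawalk_verts y q) \<subseteq> set (pawalk_verts y s)"
  proof
    fix w assume "w \<in> set (pawalk_verts y q)"
    then have "w = y \<or> (\<exists>e\<in>set q. w = fst e \<or> w = snd e)"
      using set_awalk_verts[OF qw] by auto
    then show "w \<in> set (pawalk_verts y s)"
      using qs hd_in_awalk_verts(1)[OF s] awalk_verts_arc1[of _ s y] awalk_verts_arc2[OF s]
      by (metis subsetD)
  qed
  moreover have "level z = level y" using y(2) z(2) by simp
  ultimately have "level w \<le> level y" if "w \<in> set (pawalk_verts y q)" for w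
    using sv[of w] that level_le_of_mem_walk[OF p(1), of w]
      level_le_of_mem_walk[OF p'(1), of w] p(2) p'(2) by auto
  from this[of x] have xq: "x \<notin> set (pawalk_verts y q)" using y(2) by auto
  define c where "c = (x, y) # q @ [(z, x)]"
  have qzx: "awalk y (q @ [(z, x)]) x"
    using qw z(1,4) by (intro awalk_appendI) (auto simp: awalk_simps)
  moreover have "pawalk_verts y (q @ [(z, x)]) = pawalk_verts y q @ [x]"
    using awalk_verts_append[OF qzx] by simp
  ultimately have "awalk x c x" "distinct (tl (pawalk_verts x c))"
    using arcs_symmetric[OF y(1)] qd xq
    by (simp_all only: c_def awalk_Cons_iff pawalk_verts.simps list.sel distinct_append) simp_all
  \<comment> \<open>The two arcs at \<open>x\<close> are joined by at least one arc of
    \<open>q\<close>, since \<open>y \<noteq> z\<close>.\<close>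
  moreover have "3 \<le> length c"
    using \<open>q \<noteq> []\<close> by (cases q) (simp_all add: c_def)
  ultimately have "cycle c \<and> 3 \<le> length c"
    unfolding cycle_def by (auto simp: c_def)
  then show False using tree_acyclic by blast
qed

section \<open>Subtrees of descendants\<close>

lemma descendants_subset_verts: "v \<in> pverts T \<Longrightarrow> descendants v \<subseteq> pverts T"
proof
  fix x assume "v \<in> pverts T" "x \<in> descendants v"
  from this(2,1) show "x \<in> pverts T"
    unfolding descendants_def mem_Collect_eq
    by (induction rule: rtrancl_induct) (auto dest: childD)
qed

lemma level_descendants: "x \<in> descendants v \<Longrightarrow> level v \<le> level x"
  unfolding descendants_def mem_Collect_eq
  by (induction rule: rtrancl_induct) (auto dest: childD)

text \<open>Parents are unique, so the chains from \<open>u\<close> and from \<open>v\<close> down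
  to \<open>x\<close> can be shortened together from the lower end until one of them is trivial.
  Equality of levels then makes the other trivial as well.\<close>

lemma descendants_Int_imp_eq:
  assumes "x \<in> descendants u" and "x \<in> descendants v" and "level u = level v"
  shows "u = v"
proof -
  have "(u, x) \<in> {(x, y). y \<in> children x}\<^sup>*" using assms(1) by (simp add: descendants_def)
  then show ?thesis using assms(2)
  proof (induction rule: rtrancl_induct)
    case base
    then have "(v, u) \<in> {(x, y). y \<in> children x}\<^sup>*" by (simp add: descendants_def)
    then show ?case
    proof (cases rule: rtranclE)
      case (step y)
      then have "level v \<le> level y" "level u = Suc (level y)"
        using level_descendants[of y v] by (auto simp: descendants_def dest: childD)
      then show ?thesis using assms(3) by simp
    qed simp
  next
    case (step y x)
    then have "level u \<le> level y" "x \<in> children y"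
      using level_descendants[of y u] by (auto simp: descendants_def)
    \<comment> \<open>Here \<open>x\<close> is strictly deeper than \<open>u\<close>, hence than
      \<open>v\<close>, so the chain from \<open>v\<close> has a last arc. Its source must be
      \<open>y\<close>, to which the induction hypothesis applies.\<close>
    then have "x \<noteq> v" using assms(3) childD(2) by fastforce
    moreover have "(v, x) \<in> {(x, y). y \<in> children x}\<^sup>*"
      using step.prems by (simp add: descendants_def)
    ultimately obtain y' where "y' \<in> descendants v" "x \<in> children y'"
      by (auto simp: descendants_def elim: rtranclE)
    then show ?case
      using unique_parent \<open>x \<in> children y\<close> step.IH by blast
  qed
qed

section \<open>Action of automorphisms on levels and subtrees\<close>

lemma automorphism_bij:
  assumes "g \<in> tree_automorphisms"
  shows "bij_betw g (pverts T) (pverts T)"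
  using assms by (simp add: tree_automorphisms_def Bij_def)

lemma automorphism_in_verts:
  "g \<in> tree_automorphisms \<Longrightarrow> x \<in> pverts T \<Longrightarrow> g x \<in> pverts T"
  using automorphism_bij bij_betwE by blast

text \<open>Surjectivity lets the penultimate vertex of a walk to \<open>g v\<close> be written as
  \<open>g y\<close>, after which arcs can be pulled back along \<open>g\<close>. Injectivity
  settles length 0, where \<open>g v = r = g r\<close>.\<close>

lemma automorphism_relpow:
  assumes g: "g \<in> tree_automorphisms" and "v \<in> pverts T"
  shows "(r, g v) \<in> parcs T ^^ n \<longleftrightarrow> (r, v) \<in> parcs T ^^ n"
  using \<open>v \<in> pverts T\<close>
proof (induction n arbitrary: v)
  case 0
  have "g r = r" using g by (simp add: tree_automorphisms_def)
  then show ?case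
    using 0 root_in_verts automorphism_bij[OF g] by (auto simp: bij_betw_def dest: inj_onD)
next
  case (Suc n)
  have arc: "(g x, g y) \<in> parcs T \<longleftrightarrow> (x, y) \<in> parcs T" if "x \<in> pverts T" "y \<in> pverts T" for x y
    using g that by (simp add: tree_automorphisms_def)
  have "(r, g v) \<in> parcs T ^^ Suc n \<longleftrightarrow>
      (\<exists>z\<in>pverts T. (r, z) \<in> parcs T ^^ n \<and> (z, g v) \<in> parcs T)"
    by (auto dest: in_arcsD1)
  also have "\<dots> \<longleftrightarrow> (\<exists>y\<in>pverts T. (r, g y) \<in> parcs T ^^ n \<and> (g y, g v) \<in> parcs T)"
    using automorphism_bij[OF g] unfolding bij_betw_def by (metis (no_types, lifting) imageE imageI)
  also have "\<dots> \<longleftrightarrow> (\<exists>y\<in>pverts T. (r, y) \<in> parcs T ^^ n \<and> (y, v) \<in> parcs T)"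
    using Suc arc by auto
  also have "\<dots> \<longleftrightarrow> (r, v) \<in> parcs T ^^ Suc n"
    by (auto dest: in_arcsD1)
  finally show ?case .
qed

lemma automorphism_level:
  "g \<in> tree_automorphisms \<Longrightarrow> v \<in> pverts T \<Longrightarrow> level (g v) = level v"
  by (simp add: level_relpow automorphism_relpow)

lemma automorphism_descendants:
  assumes g: "g \<in> tree_automorphisms" and "x \<in> descendants v"
  shows "g x \<in> descendants (g v)"
  using assms(2) unfolding descendants_def mem_Collect_eq
proof (induction rule: rtrancl_induct)
  case (step y z)
  then have z: "z \<in> children y" by simp
  have "(g y, g z) \<in> parcs T"
    using g childD[OF z] by (simp add: tree_automorphisms_def)
  then have "g z \<in> children (g y)"
    using childD[OF z] g by (simp add: children_def automorphism_level)
  then show ?case using step.IH by (auto intro: rtrancl_into_rtrancl)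
qed simp

section \<open>The automorphism group and rigid stabilizers\<close>

lemma Aut_simps:
  "carrier Aut = tree_automorphisms"
  "\<one>\<^bsub>Aut\<^esub> = (\<lambda>x\<in>pverts T. x)"
  by (simp_all add: Aut_def BijGroup_def)

lemma mult_Aut:
  "g \<in> tree_automorphisms \<Longrightarrow> h \<in> tree_automorphisms \<Longrightarrow> g \<otimes>\<^bsub>Aut\<^esub> h = compose (pverts T) g h"
  by (simp add: Aut_def BijGroup_def tree_automorphisms_def)

lemma mult_Aut_apply:
  "g \<in> tree_automorphisms \<Longrightarrow> h \<in> tree_automorphisms \<Longrightarrow> x \<in> pverts T \<Longrightarrow> (g \<otimes>\<^bsub>Aut\<^esub> h) x = g (h x)"
  by (simp add: mult_Aut compose_eq)

text \<open>The restriction to \<open>pverts T\<close> is there because members of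
  \<open>Bij\<close> are extensional. Arcs are preserved and reflected since \<open>g\<close> maps
  the images under the inverse back to the original vertices.\<close>

lemma inverse_automorphism:
  assumes g: "g \<in> tree_automorphisms"
  shows "(\<lambda>x\<in>pverts T. inv_into (pverts T) g x) \<in> tree_automorphisms" (is "?h \<in> _")
proof -
  note bij = automorphism_bij[OF g]
  have gB: "g \<in> Bij (pverts T)" "g r = r" using g by (auto simp: tree_automorphisms_def)
  have h: "?h x \<in> pverts T" "g (?h x) = x" if "x \<in> pverts T" for x
    using bij that by (auto simp: bij_betw_def f_inv_into_f inv_into_into)
  have "?h r = r"
    using bij gB(2) root_in_verts by (simp add: bij_betw_def inv_into_f_eq)
  moreover have "(?h x, ?h y) \<in> parcs T \<longleftrightarrow> (x, y) \<in> parcs T"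
    if "x \<in> pverts T" "y \<in> pverts T" for x y
  proof -
    have "(g (?h x), g (?h y)) \<in> parcs T \<longleftrightarrow> (?h x, ?h y) \<in> parcs T"
      using g h(1) that unfolding tree_automorphisms_def by blast
    then show ?thesis using h(2) that by metis
  qed
  ultimately show ?thesis
    using restrict_inv_into_Bij[OF gB(1)] unfolding tree_automorphisms_def by blast
qed

lemma subgroup_tree_automorphisms: "subgroup tree_automorphisms (BijGroup (pverts T))"
proof
  show "tree_automorphisms \<subseteq> carrier (BijGroup (pverts T))"
    by (auto simp: tree_automorphisms_def BijGroup_def)
  show "\<one>\<^bsub>BijGroup (pverts T)\<^esub> \<in> tree_automorphisms"
    using root_in_verts by (simp add: tree_automorphisms_def BijGroup_def id_Bij)
next
  fix g h assume gh: "g \<in> tree_automorphisms" "h \<in> tree_automorphisms"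
  have "compose (pverts T) g h \<in> tree_automorphisms"
    using gh root_in_verts automorphism_in_verts[OF gh(2)]
    by (simp add: tree_automorphisms_def compose_Bij compose_eq)
  then show "g \<otimes>\<^bsub>BijGroup (pverts T)\<^esub> h \<in> tree_automorphisms"
    using mult_Aut[OF gh] by (simp add: Aut_def)
next
  fix g assume g: "g \<in> tree_automorphisms"
  then have "g \<in> Bij (pverts T)" by (simp add: tree_automorphisms_def)
  then show "inv\<^bsub>BijGroup (pverts T)\<^esub> g \<in> tree_automorphisms"
    using inverse_automorphism[OF g] by (simp add: inv_BijGroup)
qed

lemma group_Aut: "group Aut"
  unfolding Aut_def
  using group_BijGroup subgroup_tree_automorphisms by (rule group.subgroup_imp_group)

lemma inv_Aut_apply:
  assumes "g \<in> tree_automorphisms" and "x \<in> pverts T"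
  shows "(inv\<^bsub>Aut\<^esub> g) (g x) = x"
proof -
  interpret Aut: group Aut by (rule group_Aut)
  have "inv\<^bsub>Aut\<^esub> g \<in> tree_automorphisms"
    using Aut.inv_closed[of g] assms by (simp add: Aut_simps)
  then have "(inv\<^bsub>Aut\<^esub> g) (g x) = (inv\<^bsub>Aut\<^esub> g \<otimes>\<^bsub>Aut\<^esub> g) x"
    using assms by (simp add: mult_Aut_apply)
  also have "\<dots> = x" using assms by (simp add: Aut_simps)
  finally show ?thesis .
qed

lemma subgroup_Rist:
  assumes G: "subgroup G Aut"
  shows "subgroup (Rist G v) Aut"
proof
  have GA: "G \<subseteq> tree_automorphisms" using subgroup.subset[OF G] by (simp add: Aut_simps)
  show "Rist G v \<subseteq> carrier Aut" using GA by (auto simp: Rist_def Aut_simps)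
  show "\<one>\<^bsub>Aut\<^esub> \<in> Rist G v"
    using subgroup.one_closed[OF G] by (auto simp: Rist_def Aut_simps)
  show "g \<otimes>\<^bsub>Aut\<^esub> h \<in> Rist G v" if "g \<in> Rist G v" "h \<in> Rist G v" for g h
    using that GA subgroup.m_closed[OF G] by (auto simp: Rist_def mult_Aut_apply subset_iff)
  show "inv\<^bsub>Aut\<^esub> g \<in> Rist G v" if "g \<in> Rist G v" for g
  proof -
    have g: "g \<in> G" "g \<in> tree_automorphisms" using that GA by (auto simp: Rist_def)
    \<comment> \<open>Since \<open>g x = x\<close>, applying the inverse to \<open>x\<close> is the
      same as applying it to \<open>g x\<close>.\<close>
    have "(inv\<^bsub>Aut\<^esub> g) x = x" if "x \<in> pverts T - descendants v" for x
      using inv_Aut_apply[OF g(2), of x] \<open>g \<in> Rist G v\<close> that by (simp add: Rist_def)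
    then show ?thesis using subgroup.m_inv_closed[OF G g(1)] by (simp add: Rist_def)
  qed
qed

section \<open>Elements acting on an invariant set like a given subgroup\<close>

definition agreeing :: "('v \<Rightarrow> 'v) set \<Rightarrow> ('v \<Rightarrow> 'v) set \<Rightarrow> 'v set \<Rightarrow> ('v \<Rightarrow> 'v) set" where
  "agreeing G W D = {g \<in> G. \<exists>w\<in>W. \<forall>x\<in>D. g x = w x}"

text \<open>Invariance of \<open>D\<close> under \<open>W\<close> makes agreement compatible with
  composition: \<open>h x = w' x\<close> lies again in \<open>D\<close>, so
  \<open>g (h x) = w (w' x)\<close>.\<close>

lemma subgroup_agreeing:
  assumes G: "subgroup G Aut" and W: "subgroup W Aut" and "W \<subseteq> G"
    and D: "D \<subseteq> pverts T" and inv: "\<And>w x. w \<in> W \<Longrightarrow> x \<in> D \<Longrightarrow> w x \<in> D"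
  shows "subgroup (agreeing G W D) Aut"
proof
  interpret Aut: group Aut by (rule group_Aut)
  have GA: "G \<subseteq> tree_automorphisms" using subgroup.subset[OF G] by (simp add: Aut_simps)
  show "agreeing G W D \<subseteq> carrier Aut" using GA by (auto simp: agreeing_def Aut_simps)
  show "\<one>\<^bsub>Aut\<^esub> \<in> agreeing G W D"
    using subgroup.one_closed[OF G] subgroup.one_closed[OF W] by (auto simp: agreeing_def)
  show "g \<otimes>\<^bsub>Aut\<^esub> h \<in> agreeing G W D" if gh: "g \<in> agreeing G W D" "h \<in> agreeing G W D" for g h
  proof -
    obtain w w' where w: "w \<in> W" "\<forall>x\<in>D. g x = w x" and w': "w' \<in> W" "\<forall>x\<in>D. h x = w' x"
      using gh by (auto simp: agreeing_def)
    have mem: "g \<in> G" "h \<in> G" using gh by (auto simp: agreeing_def)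
    have "(g \<otimes>\<^bsub>Aut\<^esub> h) x = (w \<otimes>\<^bsub>Aut\<^esub> w') x" if "x \<in> D" for x
      using w w' mem GA \<open>W \<subseteq> G\<close> D inv that by (simp add: mult_Aut_apply subset_iff)
    then show ?thesis
      using subgroup.m_closed[OF G] subgroup.m_closed[OF W] w w' mem unfolding agreeing_def by blast
  qed
  show "inv\<^bsub>Aut\<^esub> g \<in> agreeing G W D" if gW: "g \<in> agreeing G W D" for g
  proof -
    obtain w where w: "w \<in> W" "\<forall>x\<in>D. g x = w x" and g: "g \<in> G"
      using gW by (auto simp: agreeing_def)
    have A: "g \<in> tree_automorphisms" "w \<in> tree_automorphisms" using g w GA \<open>W \<subseteq> G\<close> by auto
    have iw: "inv\<^bsub>Aut\<^esub> w \<in> W" using subgroup.m_inv_closed[OF W w(1)] .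
    have "(inv\<^bsub>Aut\<^esub> g) x = (inv\<^bsub>Aut\<^esub> w) x" if "x \<in> D" for x
    proof -
      \<comment> \<open>This \<open>y\<close> stays in \<open>D\<close> because \<open>W\<close>
        contains the inverse of \<open>w\<close>. Hence \<open>g y = w y = x\<close>, which
        identifies \<open>y\<close> as the image of \<open>x\<close> under the inverse of
        \<open>g\<close>.\<close>
      define y where "y = (inv\<^bsub>Aut\<^esub> w) x"
      have y: "y \<in> D" unfolding y_def using inv iw that .
      have "inv\<^bsub>Aut\<^esub> w \<in> tree_automorphisms" using iw GA \<open>W \<subseteq> G\<close> by auto
      then have "w y = (w \<otimes>\<^bsub>Aut\<^esub> inv\<^bsub>Aut\<^esub> w) x"
        unfolding y_def using A that D by (auto simp: mult_Aut_apply)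
      also have "\<dots> = x" using A that D by (auto simp: Aut_simps)
      finally have "g y = x" using w y by simp
      then show ?thesis using inv_Aut_apply[OF A(1), of y] y D unfolding y_def by auto
    qed
    then show ?thesis
      using subgroup.m_inv_closed[OF G g] iw unfolding agreeing_def by blast
  qed
qed

text \<open>Choosing for each element some member of \<open>W\<close> that it agrees with on
  \<open>D\<close> is injective: the choice fixes the action on the subtree at \<open>u\<close>, and
  outside it the element is the identity.\<close>

lemma finite_agreeing_Int_Rist:
  assumes G: "G \<subseteq> tree_automorphisms" and "finite W" and D: "descendants u \<subseteq> D"
  shows "finite (agreeing G W D \<inter> Rist G u)"
proof -
  let ?F = "agreeing G W D \<inter> Rist G u"
  have "\<forall>g\<in>?F. \<exists>w\<in>W. \<forall>x\<in>D. g x = w x" by (auto simp: agreeing_def)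
  then obtain w where w: "\<And>g. g \<in> ?F \<Longrightarrow> w g \<in> W \<and> (\<forall>x\<in>D. g x = w g x)" by metis
  have "inj_on w ?F"
  proof (rule inj_onI)
    fix g h assume g: "g \<in> ?F" and h: "h \<in> ?F" and eq: "w g = w h"
    \<comment> \<open>Automorphisms take the default value \<open>undefined\<close> off the vertex
      set, so it suffices to compare them on vertices.\<close>
    have "g \<in> extensional (pverts T)" "h \<in> extensional (pverts T)"
      using g h G by (auto simp: Rist_def tree_automorphisms_def Bij_def)
    then show "g = h"
    proof (rule extensionalityI)
      fix x assume "x \<in> pverts T"
      then show "g x = h x"
        using w[OF g] w[OF h] eq g h D by (cases "x \<in> descendants u") (auto simp: Rist_def)
    qed
  qed
  moreover have "w ` ?F \<subseteq> W" using w by blast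
  ultimately show ?thesis using \<open>finite W\<close> finite_imageD finite_subset by blast
qed

end

section \<open>Wide levels and infinitude of weakly maximal subgroups\<close>

context spherically_regular_rooted_tree
begin

text \<open>Each vertex of \<open>A\<close> contributes one child, and one vertex contributes a
  second. Uniqueness of parents keeps all of these distinct, so the next level gains at least one
  vertex.\<close>

lemma ex_large_level:
  "\<exists>n A. A \<subseteq> {v \<in> pverts T. level v = n} \<and> finite A \<and> card A = Suc k"
proof (induction k)
  case 0
  then show ?case
    using root_in_verts by (intro exI[of _ "level r"] exI[of _ "{r}"]) auto
next
  case (Suc k)
  then obtain n A where A: "A \<subseteq> {v \<in> pverts T. level v = n}" "finite A" "card A = Suc k"
    by blast
  have "\<forall>v\<in>A. \<exists>a b. a \<noteq> b \<and> {a, b} \<subseteq> children v" using A two_children by blast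
  then obtain a b where ab: "\<And>v. v \<in> A \<Longrightarrow> a v \<noteq> b v \<and> a v \<in> children v \<and> b v \<in> children v"
    by (metis insert_subset)
  \<comment> \<open>Any vertex of \<open>A\<close> can supply the extra child; \<open>A\<close> is
    nonempty because its size is a successor.\<close>
  obtain v where v: "v \<in> A" using A(3) by fastforce
  have "inj_on a A" using ab unique_parent by (metis inj_onI)
  moreover have "b v \<notin> a ` A" using ab unique_parent v by (metis imageE)
  ultimately have "card (insert (b v) (a ` A)) = Suc (Suc k)"
    using A by (simp add: card_image)
  moreover have "x \<in> {v \<in> pverts T. level v = Suc n}" if "w \<in> A" "x \<in> children w" for w x
    using childD[OF that(2)] that(1) A(1) by auto
  then have "insert (b v) (a ` A) \<subseteq> {v \<in> pverts T. level v = Suc n}"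
    using ab v by blast
  ultimately show ?case
    using A(2) by (intro exI[of _ "Suc n"] exI[of _ "insert (b v) (a ` A)"]) simp
qed

lemma infinite_weakly_maximal:
  assumes G: "subgroup G Aut" and Rist: "\<And>v. v \<in> pverts T \<Longrightarrow> infinite (Rist G v)"
    and W: "weakly_maximal W (Aut\<lparr>carrier := G\<rparr>)"
  shows "infinite W"
proof
  assume "finite W"
  interpret Aut: group Aut by (rule group_Aut)
  let ?G = "Aut\<lparr>carrier := G\<rparr>"
  interpret G: group ?G using G by (rule Aut.subgroup_imp_group)
  have WG: "subgroup W ?G" using W by (simp add: weakly_maximal_def)
  have WA: "subgroup W Aut" using G WG by (rule Aut.incl_subgroup)
  have "W \<subseteq> G" using subgroup.subset[OF WG] by simp
  have GA: "G \<subseteq> tree_automorphisms" using subgroup.subset[OF G] by (simp add: Aut_simps)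
  \<comment> \<open>One vertex more than \<open>card W\<close> suffices, as the
    \<open>W\<close>-orbit of any \<open>u\<close> has at most \<open>card W\<close> points.\<close>
  obtain n A where A: "A \<subseteq> {v \<in> pverts T. level v = n}" "finite A" "card A = Suc (card W)"
    using ex_large_level by blast
  then obtain u where "u \<in> A" by fastforce
  then have u: "u \<in> pverts T" "level u = n" using A by auto
  have "card ((\<lambda>w. w u) ` W) < card A"
    using card_image_le[OF \<open>finite W\<close>, of "\<lambda>w. w u"] A(3) by simp
  then have "\<not> A \<subseteq> (\<lambda>w. w u) ` W"
    using card_mono[OF finite_imageI[OF \<open>finite W\<close>]] by (metis not_le)
  then obtain v where "v \<in> A" and v_orbit: "\<And>w. w \<in> W \<Longrightarrow> v \<noteq> w u" by blast
  then have v: "v \<in> pverts T" "level v = n" using A by auto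
  define D where "D = (\<Union>w\<in>W. w ` descendants u)"
  have verts_u: "descendants u \<subseteq> pverts T" using descendants_subset_verts u(1) .
  have D_verts: "D \<subseteq> pverts T"
    unfolding D_def using verts_u automorphism_in_verts GA \<open>W \<subseteq> G\<close> by blast
  have D_inv: "w x \<in> D" if w: "w \<in> W" and x: "x \<in> D" for w x
  proof -
    obtain w' y where y: "w' \<in> W" "y \<in> descendants u" "x = w' y" using x by (auto simp: D_def)
    then have "w x = (w \<otimes>\<^bsub>Aut\<^esub> w') y"
      using w GA \<open>W \<subseteq> G\<close> verts_u by (simp add: mult_Aut_apply subset_iff)
    then show ?thesis using y subgroup.m_closed[OF WA w y(1)] by (auto simp: D_def)
  qed
  have oneW: "\<one>\<^bsub>Aut\<^esub> \<in> W" using subgroup.one_closed[OF WA] .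
  have u_D: "descendants u \<subseteq> D"
  proof
    fix x assume x: "x \<in> descendants u"
    then have "\<one>\<^bsub>Aut\<^esub> x = x" using verts_u by (auto simp: Aut_simps)
    with x oneW show "x \<in> D" unfolding D_def by (metis UN_I imageI)
  qed
  \<comment> \<open>A common point lies below both \<open>v\<close> and some \<open>w u\<close>.
    These have the same level, so they coincide, contrary to the choice of \<open>v\<close> outside
    the orbit.\<close>
  have v_D: "descendants v \<inter> D = {}"
  proof (rule ccontr)
    assume "descendants v \<inter> D \<noteq> {}"
    then obtain w y where w: "w \<in> W" "y \<in> descendants u" "w y \<in> descendants v"
      by (auto simp: D_def)
    then have wA: "w \<in> tree_automorphisms" using GA \<open>W \<subseteq> G\<close> by blast
    have "v = w u"
      using descendants_Int_imp_eq[OF w(3) automorphism_descendants[OF wA w(2)]]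
        automorphism_level[OF wA u(1)] u v by simp
    then show False using v_orbit w(1) by blast
  qed
  define H where "H = agreeing G W D"
  have HA: "subgroup H Aut"
    unfolding H_def using G WA \<open>W \<subseteq> G\<close> D_verts D_inv by (rule subgroup_agreeing)
  have HG: "subgroup H ?G"
    using Aut.subgroup_incl[OF HA G] by (auto simp: H_def agreeing_def)
  have RG: "subgroup (Rist G u) ?G"
    using Aut.subgroup_incl[OF subgroup_Rist[OF G] G] by (auto simp: Rist_def)
  have "infinite_index H ?G"
    using HG RG Rist[OF u(1)] finite_agreeing_Int_Rist[OF GA \<open>finite W\<close> u_D]
    unfolding H_def by (rule G.infinite_index_if_finite_Int)
  moreover have "W \<subseteq> H" using \<open>W \<subseteq> G\<close> by (auto simp: H_def agreeing_def)
  ultimately have "H = W" using W HG by (simp add: weakly_maximal_def)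
  \<comment> \<open>Elements of \<open>Rist G v\<close> move only points below \<open>v\<close>,
    hence agree on \<open>D\<close> with the identity, which belongs to \<open>W\<close>.\<close>
  moreover have "Rist G v \<subseteq> H"
  proof
    fix g assume g: "g \<in> Rist G v"
    then have "\<forall>x\<in>D. g x = \<one>\<^bsub>Aut\<^esub> x"
      using D_verts v_D by (auto simp: Rist_def Aut_simps)
    then show "g \<in> H" using g oneW unfolding H_def agreeing_def Rist_def by blast
  qed
  ultimately show False
    using Rist[OF v(1)] \<open>finite W\<close> finite_subset by blast
qed

end

theorem lemma1p4:
  fixes T :: "'v pair_pre_digraph" and r :: 'v and G :: "('v \<Rightarrow> 'v) set"
  assumes "spherically_regular_rooted_tree T r"
    and "rooted_tree.locally_finite T"
    and "subgroup G (rooted_tree.Aut T r)"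
    and "\<forall>v\<in>pverts T. infinite (rooted_tree.Rist T r G v)"
  shows "\<forall>W. weakly_maximal W (rooted_tree.Aut T r \<lparr>carrier := G\<rparr>) \<longrightarrow> infinite W"
  using spherically_regular_rooted_tree.infinite_weakly_maximal[OF assms(1,3)] assms(4) by blast

end
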